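(* Let $n\ge1$, let $v_1,\dots,v_h\in\mathbb Z^n$ and let $M\ge1$ be an integer. Let $k\ge3$ and let $(w_1,\dots,w_k),(w_1',\dots,w_k')$ be $M$-big ordered $k$-tuples of vectors of $\mathbb Z^n$. Then the following are equivalent: 1. There is a sequence of Nielsen moves and Nielsen moves relative to $v_1,\dots,v_h$ going from $(w_1,\dots,w_k)$ to $(w_1',\dots,w_k')$ such that all the $k$-tuples along the sequence are $M$-big. 2. $A(w_1,\dots,w_k;v_1,\dots,v_h)=A(w_1',\dots,w_k';v_1,\dots,v_h)=A$, and the two ordered $k$-tuples of generators $([w_1],\dots,[w_k])$ and $([w_1'],\dots,[w_k'])$ are Nielsen equivalent in $A$.
   Context: An ordered $k$-tuple $(w_1,\dots,w_k)$ of vectors of $\mathbb Z^n$ is $M$-big if each component of each $w_i$ is $\ge M$. A Nielsen move on an ordered $k$-tuple of elements of an abelian group replaces some $w_i$ with $w_i+w_j$ or $w_i-w_j$ for some $j\ne i$; two ordered $k$-tuples are Nielsen equivalent if there is a finite sequence of Nielsen moves from one to the other. A Nielsen move relative to $v_1,\dots,v_h$ replaces some $w_i$ with $w_i+v_j$ or $w_i-v_j$ for some $j\in\{1,\dots,h\}$. Define $A(w_1,\dots,w_k;v_1,\dots,v_h)=\langle v_1,\dots,v_h,w_1,\dots,w_k\rangle/\langle v_1,\dots,v_h\rangle$, where $\langle\cdot\rangle$ denotes the subgroup of $\mathbb Z^n$ generated; equality of two such groups means that the subgroups $\langle v_1,\dots,v_h,w_1,\dots,w_k\rangle$ and $\langle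 v_1,\dots,v_h,w_1',\dots,w_k'\rangle$ coincide. $[w]$ denotes the class of $w$ in the quotient. *)

theory Defs
  imports "HOL-Analysis.Finite_Cartesian_Product" "HOL-Algebra.Generated_Groups"
begin

text \<open>Ordered tuples are lists. The groups below are abelian but written multiplicatively, as in
  HOL-Algebra, so \<open>w\<^sub>i - w\<^sub>j\<close> reads \<open>w\<^sub>i \<otimes> inv w\<^sub>j\<close>.\<close>

definition nielsen_move :: "('a, 'b) monoid_scheme \<Rightarrow> 'a list \<Rightarrow> 'a list \<Rightarrow> bool" where
  "nielsen_move G ws ws' \<longleftrightarrow>
     (\<exists>i < length ws. \<exists>j < length ws. j \<noteq> i \<and>
        (ws' = ws[i := ws ! i \<otimes>\<^bsub>G\<^esub> ws ! j] \<or>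
         ws' = ws[i := ws ! i \<otimes>\<^bsub>G\<^esub> inv\<^bsub>G\<^esub> (ws ! j)]))"

definition nielsen_move_rel ::
    "('a, 'b) monoid_scheme \<Rightarrow> 'a list \<Rightarrow> 'a list \<Rightarrow> 'a list \<Rightarrow> bool" where
  "nielsen_move_rel G vs ws ws' \<longleftrightarrow>
     (\<exists>i < length ws. \<exists>j < length vs.
        ws' = ws[i := ws ! i \<otimes>\<^bsub>G\<^esub> vs ! j] \<or>
        ws' = ws[i := ws ! i \<otimes>\<^bsub>G\<^esub> inv\<^bsub>G\<^esub> (vs ! j)])"

definition nielsen_equivalent ::
    "('a, 'b) monoid_scheme \<Rightarrow> 'a list \<Rightarrow> 'a list \<Rightarrow> bool" where
  "nielsen_equivalent G = (nielsen_move G)\<^sup>*\<^sup>*"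

definition Zn :: "(int ^ 'n) monoid" where
  "Zn = \<lparr>carrier = UNIV, monoid.mult = (+), one = 0\<rparr>"

definition M_big :: "int \<Rightarrow> (int ^ 'n) list \<Rightarrow> bool" where
  "M_big M ws \<longleftrightarrow> (\<forall>w \<in> set ws. \<forall>i. M \<le> w $ i)"

text \<open>A step between two \<open>M\<close>-big tuples. Under the reflexive transitive closure, every tuple
  along a sequence is \<open>M\<close>-big as soon as the initial one is.\<close>

definition big_step ::
    "int \<Rightarrow> (int ^ 'n) list \<Rightarrow> (int ^ 'n) list \<Rightarrow> (int ^ 'n) list \<Rightarrow> bool" where
  "big_step M vs ws ws' \<longleftrightarrow>
     M_big M ws \<and> M_big M ws' \<and> (nielsen_move Zn ws ws' \<or> nielsen_move_rel Zn vs ws ws')"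

text \<open>\<open>quot_A ws vs\<close> is the group \<open>A(w\<^sub>1,\<dots>,w\<^sub>k; v\<^sub>1,\<dots>,v\<^sub>h)\<close>, and \<open>quot_class vs w\<close> is
  the coset \<open>[w]\<close>.\<close>

definition quot_A :: "(int ^ 'n) list \<Rightarrow> (int ^ 'n) list \<Rightarrow> (int ^ 'n) set monoid" where
  "quot_A ws vs =
     (Zn\<lparr>carrier := generate Zn (set vs \<union> set ws)\<rparr>) Mod (generate Zn (set vs))"

definition quot_class :: "(int ^ 'n) list \<Rightarrow> int ^ 'n \<Rightarrow> (int ^ 'n) set" where
  "quot_class vs w = generate Zn (set vs) #>\<^bsub>Zn\<^esub> w"

lemma comm_group_Zn: "comm_group (Zn :: (int ^ 'n) monoid)"
proof (rule comm_groupI)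
  fix x :: "int ^ 'n"
  show "\<exists>y \<in> carrier Zn. y \<otimes>\<^bsub>Zn\<^esub> x = \<one>\<^bsub>Zn\<^esub>"
    by (intro bexI[of _ "- x"]) (simp_all add: Zn_def)
qed (simp_all add: Zn_def algebra_simps)

lemma inv_Zn: "inv\<^bsub>Zn\<^esub> x = - (x :: int ^ 'n)"
proof -
  interpret comm_group "Zn :: (int ^ 'n) monoid" by (rule comm_group_Zn)
  show ?thesis by (rule inv_equality) (simp_all add: Zn_def)
qed

lemma comm_group_quot_A: "comm_group (quot_A ws (vs :: (int ^ 'n) list))"
proof -
  interpret comm_group "Zn :: (int ^ 'n) monoid" by (rule comm_group_Zn)
  let ?K = "generate Zn (set vs \<union> set ws)" and ?H = "generate Zn (set vs)"
  have K: "subgroup ?K Zn" and H: "subgroup ?H Zn"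
    by (rule generate_is_subgroup, simp add: Zn_def)+
  interpret K: comm_group "Zn\<lparr>carrier := ?K\<rparr>"
    using subgroup.subgroup_is_group[OF K is_group]
    by (rule group.group_comm_groupI) (simp add: Zn_def algebra_simps)
  have "subgroup ?H (Zn\<lparr>carrier := ?K\<rparr>)"
    by (rule subgroup_incl[OF H K]) (simp add: mono_generate)
  then show ?thesis
    unfolding quot_A_def by (rule K.abelian_FactGroup)
qed

lemma quot_class_in_carrier:
  assumes "w \<in> generate Zn (set vs \<union> set ws)"
  shows "quot_class vs w \<in> carrier (quot_A ws vs)"
  using assms unfolding quot_A_def quot_class_def carrier_FactGroup
  by (auto simp: r_coset_def)

end

theory Submission
  imports Defs
begin

text \<open>
  One direction is bookkeeping: a Nielsen move keeps the generated subgroup and descends to a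
  Nielsen move of classes, a relative move does not change the classes.

  For the other direction, a Nielsen path in the quotient lifts to a path of moves from \<open>ws\<close> to
  \<open>ws'\<close> in \<open>\<int>\<^sup>n\<close>, but its intermediate tuples need not be big. Bigness is restored in two stages.

  \<^bold>\<open>Pivots.\<close> A tuple with a big entry, the pivot, stands for the big tuples obtained from it
  by adding multiples of the pivot to the other entries. Any two of these are joined by a big path,
  also if they come from different pivots of the same tuple (\<open>big_path_of_representatives\<close>).
  Hence it is enough to reach \<open>ws'\<close> from \<open>ws\<close> by moves that change an entry while some other entry
  is big (\<open>pivot_path_imp_big_path\<close>).

  \<^bold>\<open>Transvections.\<close> Fix the big vector \<open>C\<close> = the first entry of \<open>ws\<close>. Let \<open>c\<close> be coordinates of
  \<open>C\<close> in a tuple \<open>u\<close>, up to the relators, and let \<open>f\<close> be an integer functional that vanishes on \<open>c\<close>.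
  The transvection \<open>u\<^sub>i \<mapsto> u\<^sub>i + f\<^sub>i C\<close> fixes \<open>C\<close> and carries moves to moves, so it transports
  the whole path, and it makes every entry with \<open>f\<^sub>i\<close> large big. It remains to deal with the values of
  \<open>f\<close> along the path. Since \<open>k \<ge> 3\<close>, a transvection whose functional vanishes on the pivot is itself
  a pivot path (\<open>transvection_pivot_path\<close>); so \<open>f\<close> can be exchanged for any functional in \<open>c\<^sup>\<bottom>\<close> with
  the same value on the pivot. In this way, before an entry is changed, another entry is made big;
  and at the end, a functional that vanishes on an entry of the big tuple \<open>ws'\<close> lets the
  transvection be undone. Each exchange divides by a coordinate of \<open>C\<close>, which is why \<open>f\<close> has to
  start out highly divisible; the divisibility is found by induction from the end of the path
  (\<open>transvected_path\<close>).
\<close>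

section \<open>Integer vectors and tuples\<close>

interpretation zv: module "(*s) :: int \<Rightarrow> int ^ 'n \<Rightarrow> int ^ 'n"
  by standard (auto simp: vec_eq_iff algebra_simps)

lemma rtranclp_symI:
  assumes "\<And>x y. R x y \<Longrightarrow> R y x" and "R\<^sup>*\<^sup>* x y"
  shows "R\<^sup>*\<^sup>* y x"
  using assms(2) by induction (auto intro: converse_rtranclp_into_rtranclp assms(1))

text \<open>Tuples are functions of which only the values below \<open>k\<close> matter; this makes simultaneous changes
  of many entries easy to write.\<close>

locale positive_tuples =
  fixes M :: int and k :: nat and vs :: "(int ^ 'n) list"
  assumes M_pos: "1 \<le> M" and k_ge_3: "3 \<le> k"
begin

definition big :: "int ^ 'n \<Rightarrow> bool" where
  "big x \<longleftrightarrow> (\<forall>t. M \<le> x $ t)"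

definition all_big :: "(nat \<Rightarrow> int ^ 'n) \<Rightarrow> bool" where
  "all_big u \<longleftrightarrow> (\<forall>i<k. big (u i))"

definition addends :: "nat \<Rightarrow> (nat \<Rightarrow> int ^ 'n) \<Rightarrow> (int ^ 'n) set" where
  "addends i u = u ` ({..<k} - {i}) \<union> set vs"

definition move :: "nat \<Rightarrow> (nat \<Rightarrow> int ^ 'n) \<Rightarrow> (nat \<Rightarrow> int ^ 'n) \<Rightarrow> bool" where
  "move i u u' \<longleftrightarrow> i < k \<and> (\<exists>a \<in> addends i u. \<exists>s. \<bar>s\<bar> = 1 \<and> u' = u(i := u i + s *s a))"

definition big_move :: "(nat \<Rightarrow> int ^ 'n) \<Rightarrow> (nat \<Rightarrow> int ^ 'n) \<Rightarrow> bool" where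
  "big_move u u' \<longleftrightarrow> all_big u \<and> all_big u' \<and> (\<exists>i. move i u u')"

text \<open>A weakening of \<open>big_move\<close> that nevertheless connects the same big tuples, as shown in
  \<open>pivot_path_imp_big_path\<close>.\<close>

definition pivot_move :: "(nat \<Rightarrow> int ^ 'n) \<Rightarrow> (nat \<Rightarrow> int ^ 'n) \<Rightarrow> bool" where
  "pivot_move u u' \<longleftrightarrow> (\<exists>i l. move i u u' \<and> l < k \<and> l \<noteq> i \<and> big (u l))"

definition shear :: "nat \<Rightarrow> (nat \<Rightarrow> int) \<Rightarrow> (nat \<Rightarrow> int ^ 'n) \<Rightarrow> nat \<Rightarrow> int ^ 'n" where
  "shear l N u = (\<lambda>i. if i < k \<and> i \<noteq> l then u i + N i *s u l else u i)"

definition rep :: "(nat \<Rightarrow> int ^ 'n) \<Rightarrow> (nat \<Rightarrow> int ^ 'n) \<Rightarrow> bool" where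
  "rep u x \<longleftrightarrow> all_big x \<and> (\<exists>l<k. \<exists>N. big (u l) \<and> x = shear l N u)"

lemma big_add_nonneg:
  assumes "big x" and "\<And>t. 0 \<le> y $ t"
  shows "big (x + y)"
  unfolding big_def
proof
  fix t
  show "M \<le> (x + y) $ t"
    using assms(1)[unfolded big_def, rule_format, of t] assms(2)[of t] by simp
qed

lemma big_nonneg: "big x \<Longrightarrow> 0 \<le> x $ t"
  using M_pos by (auto simp: big_def intro: order_trans[of 0 M])

lemma big_shift:
  assumes "big p"
  shows "\<exists>N0\<ge>0. \<forall>i<k. \<forall>N\<ge>N0. big (u i + N *s p)"
proof -
  define N0 where "N0 = M + (\<Sum>i<k. \<Sum>t\<in>UNIV. \<bar>u i $ t\<bar>)"
  have "big (u i + N *s p)" if "i < k" "N \<ge> N0" for i N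
    unfolding big_def
  proof
    fix t
    have "\<bar>u i $ t\<bar> \<le> (\<Sum>t\<in>UNIV. \<bar>u i $ t\<bar>)"
      by (rule member_le_sum) auto
    also have "\<dots> \<le> (\<Sum>i<k. \<Sum>t\<in>UNIV. \<bar>u i $ t\<bar>)"
      using \<open>i < k\<close> by (intro member_le_sum[of i _ "\<lambda>i. \<Sum>t\<in>UNIV. \<bar>u i $ t\<bar>"]) (auto intro: sum_nonneg)
    finally have 1: "M - u i $ t \<le> N" and "0 \<le> N"
      using that M_pos by (auto simp: N0_def)
    have "1 \<le> p $ t" using assms M_pos by (auto simp: big_def intro: order_trans[of 1 M])
    then have "N \<le> N * p $ t" using \<open>0 \<le> N\<close> mult_left_mono[of 1 "p $ t" N] by simp
    then show "M \<le> (u i + N *s p) $ t" using 1 by simp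
  qed
  moreover have "0 \<le> N0" using M_pos by (auto simp: N0_def intro!: add_nonneg_nonneg sum_nonneg)
  ultimately show ?thesis by blast
qed

lemma other_index: "\<exists>m<k. m \<noteq> i \<and> m \<noteq> j"
proof -
  have "card {i, j} < card {..<k}" using k_ge_3 card_insert_le_m1[of 2 "{j}" i]
    by (auto simp: card_insert_if)
  then have "\<not> {..<k} \<subseteq> {i, j}" by (meson card_mono finite.intros leD)
  then show ?thesis by auto
qed

lemma moveI:
  assumes "i < k" "a \<in> addends i u" "\<bar>s\<bar> = 1"
  shows "move i u (u(i := u i + s *s a))"
  using assms unfolding move_def by blast

lemma addends_upd [simp]: "addends i (u(i := x)) = addends i u"
  unfolding addends_def by (auto intro: image_cong)

lemma move_sym:
  assumes "move i u u'"
  shows "move i u' u"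
proof -
  obtain a s where *: "i < k" "a \<in> addends i u" "\<bar>s\<bar> = 1" "u' = u(i := u i + s *s a)"
    using assms unfolding move_def by blast
  have "u = u'(i := u' i + (- s) *s a)" using * by simp
  moreover have "a \<in> addends i u'" using * by simp
  ultimately show ?thesis using * unfolding move_def
    by (intro conjI bexI[of _ a] exI[of _ "- s"]) auto
qed

lemma big_move_sym: "big_move\<^sup>*\<^sup>* u u' \<Longrightarrow> big_move\<^sup>*\<^sup>* u' u"
  by (rule rtranclp_symI) (auto simp: big_move_def intro: move_sym)

lemma move_other: "move i u u' \<Longrightarrow> l \<noteq> i \<Longrightarrow> u' l = u l"
  by (auto simp: move_def)

lemma pivot_move_sym: "pivot_move\<^sup>*\<^sup>* u u' \<Longrightarrow> pivot_move\<^sup>*\<^sup>* u' u"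
  by (rule rtranclp_symI) (unfold pivot_move_def, metis move_sym move_other)

section \<open>Big representatives of tuples with a pivot\<close>

lemma all_big_add_multiple:
  assumes "all_big x" "i < k" "l < k" "i \<noteq> l"
  shows "all_big (x(i := x i + int n *s x l)) \<and> big_move\<^sup>*\<^sup>* x (x(i := x i + int n *s x l))"
proof (induction n)
  case 0
  then show ?case using assms by simp
next
  case (Suc n)
  let ?y = "x(i := x i + int n *s x l)" and ?z = "x(i := x i + int (Suc n) *s x l)"
  have eq: "?z = ?y(i := ?y i + 1 *s x l)"
    by (simp add: zv.scale_left_distrib algebra_simps)
  have "move i ?y ?z"
    unfolding eq by (rule moveI) (use assms in \<open>auto simp: addends_def\<close>)
  moreover have "all_big ?z"
  proof -
    have "big (x i + int (Suc n) *s x l)"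
      by (rule big_add_nonneg) (use assms big_nonneg in \<open>auto simp: all_big_def\<close>)
    then show ?thesis using assms by (auto simp: all_big_def)
  qed
  ultimately show ?case using Suc unfolding big_move_def
    by (metis (no_types, lifting) big_move_def rtranclp.rtrancl_into_rtrancl)
qed

lemma big_add_multiples:
  assumes "all_big x" "l < k" "finite S" "S \<subseteq> {..<k} - {l}" "\<And>i. i \<in> S \<Longrightarrow> 0 \<le> n i"
  shows "big_move\<^sup>*\<^sup>* x (\<lambda>i. if i \<in> S then x i + n i *s x l else x i) \<and>
    all_big (\<lambda>i. if i \<in> S then x i + n i *s x l else x i)"
  using assms(3-5)
proof (induction S)
  case empty
  then show ?case using assms by simp
next
  case (insert j S)
  let ?y = "\<lambda>i. if i \<in> S then x i + n i *s x l else x i"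
  have eq: "(\<lambda>i. if i \<in> insert j S then x i + n i *s x l else x i)
    = ?y(j := ?y j + int (nat (n j)) *s ?y l)"
    using insert.hyps insert.prems by (auto simp: fun_eq_iff)
  show ?case unfolding eq
    using insert all_big_add_multiple[of ?y j l "nat (n j)"] assms(2)
    by (auto intro: rtranclp_trans)
qed

lemma shear_shear: "l < k \<Longrightarrow> shear l N' (shear l N u) = shear l (\<lambda>i. N i + N' i) u"
  by (auto simp: shear_def fun_eq_iff zv.scale_left_distrib)

lemma shear_nonneg:
  assumes "all_big x" "l < k" "\<And>i. 0 \<le> N i"
  shows "big_move\<^sup>*\<^sup>* x (shear l N x)"
proof -
  have "shear l N x = (\<lambda>i. if i \<in> {..<k} - {l} then x i + N i *s x l else x i)"
    by (auto simp: shear_def fun_eq_iff)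
  then show ?thesis using big_add_multiples[of x l "{..<k} - {l}" N] assms by simp
qed

text \<open>Increasing the multipliers is a big path, so both sides lead to the pointwise maximum.\<close>

lemma shear_unique:
  assumes "l < k" "all_big (shear l N u)" "all_big (shear l N' u)"
  shows "big_move\<^sup>*\<^sup>* (shear l N u) (shear l N' u)"
proof -
  let ?K = "\<lambda>i. max (N i) (N' i)"
  have "big_move\<^sup>*\<^sup>* (shear l N u) (shear l ?K u)"
    using shear_nonneg[OF assms(2,1), of "\<lambda>i. ?K i - N i"] by (simp add: shear_shear assms)
  moreover have "big_move\<^sup>*\<^sup>* (shear l N' u) (shear l ?K u)"
    using shear_nonneg[OF assms(3,1), of "\<lambda>i. ?K i - N' i"] by (simp add: shear_shear assms)
  ultimately show ?thesis by (blast intro: rtranclp_trans big_move_sym)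
qed

text \<open>Both sides reach the tuple in which every entry other than \<open>u\<^sub>l\<close>, \<open>u\<^sub>j\<close> has received the
  same large multiple of \<open>u\<^sub>l + u\<^sub>j\<close>.\<close>

lemma shear_change_pivot:
  assumes "l < k" "j < k" "l \<noteq> j" "big (u l)" "big (u j)"
    and "all_big (shear l N u)" "all_big (shear j N' u)"
  shows "big_move\<^sup>*\<^sup>* (shear l N u) (shear j N' u)"
proof -
  obtain K1 where K1: "K1 \<ge> 0" "\<And>i N. i < k \<Longrightarrow> N \<ge> K1 \<Longrightarrow> big (u i + N *s u l)"
    using big_shift[OF assms(4), of u] by blast
  obtain K2 where K2: "K2 \<ge> 0" "\<And>i N. i < k \<Longrightarrow> N \<ge> K2 \<Longrightarrow> big (u i + N *s u j)"
    using big_shift[OF assms(5), of u] by blast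
  define K where "K = max K1 K2"
  let ?S = "{..<k} - {l, j}"
  let ?y = "shear l (\<lambda>i. if i = j then 0 else K) u"
  let ?z = "shear j (\<lambda>i. if i = l then 0 else K) u"
  have yb: "all_big ?y" and zb: "all_big ?z"
    using K1 K2 assms by (auto simp: all_big_def shear_def K_def)
  have "big_move\<^sup>*\<^sup>* ?y (\<lambda>i. if i \<in> ?S then ?y i + K *s ?y j else ?y i)"
    by (rule big_add_multiples[OF yb assms(2), THEN conjunct1]) (use K1 in \<open>auto simp: K_def\<close>)
  moreover have "big_move\<^sup>*\<^sup>* ?z (\<lambda>i. if i \<in> ?S then ?z i + K *s ?z l else ?z i)"
    by (rule big_add_multiples[OF zb assms(1), THEN conjunct1]) (use K1 in \<open>auto simp: K_def\<close>)
  moreover have "(\<lambda>i. if i \<in> ?S then ?y i + K *s ?y j else ?y i)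
      = (\<lambda>i. if i \<in> ?S then ?z i + K *s ?z l else ?z i)"
    using assms by (auto simp: fun_eq_iff shear_def)
  ultimately have "big_move\<^sup>*\<^sup>* ?y ?z"
    by (metis (no_types, lifting) big_move_sym rtranclp_trans)
  then show ?thesis
    using shear_unique[OF assms(1,6) yb] shear_unique[OF assms(2) zb assms(7)]
    by (meson rtranclp_trans)
qed

lemma rep_unique:
  assumes "rep u x" "rep u y"
  shows "big_move\<^sup>*\<^sup>* x y"
  using assms unfolding rep_def
  by (metis shear_unique shear_change_pivot)

text \<open>A move at \<open>i\<close> by \<open>u\<^sub>j\<close> becomes, after the shear, a move by \<open>u\<^sub>j + K u\<^sub>l\<close>; the entry at \<open>i\<close>
  gets the larger multiple \<open>2 K u\<^sub>l\<close> so that it stays big under subtraction.\<close>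

lemma pivot_move_rep:
  assumes "pivot_move u u'"
  shows "\<exists>x x'. rep u x \<and> rep u' x' \<and> big_move\<^sup>*\<^sup>* x x'"
proof -
  obtain i l where il: "move i u u'" "l < k" "l \<noteq> i" "big (u l)"
    using assms unfolding pivot_move_def by blast
  then obtain a s where as: "i < k" "a \<in> addends i u" "\<bar>s\<bar> = 1" "u' = u(i := u i + s *s a)"
    unfolding move_def by blast
  obtain K1 where K1: "K1 \<ge> 0" "\<And>i N. i < k \<Longrightarrow> N \<ge> K1 \<Longrightarrow> big (u i + N *s u l)"
    using big_shift[OF il(4), of u] by blast
  obtain K2 where K2: "K2 \<ge> 0" "\<And>i N. i < k \<Longrightarrow> N \<ge> K2 \<Longrightarrow> big (u' i + N *s u l)"
    using big_shift[OF il(4), of u'] by blast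
  define K where "K = max K1 K2"
  define x where "x = shear l (\<lambda>m. if m = i then 2 * K else K) u"
  \<comment> \<open>The case \<open>e = 1\<close> is that of an added entry which the shear itself changes.\<close>
  have "\<exists>e\<in>{0,1}. a + (e * K) *s u l \<in> addends i x"
  proof (cases "a \<in> set vs \<or> a = u l")
    case True
    moreover have "x l = u l" by (simp add: x_def shear_def)
    moreover have "x l \<in> x ` ({..<k} - {i})" by (rule imageI) (use il in auto)
    ultimately have "a \<in> addends i x" by (auto simp: addends_def)
    then show ?thesis by auto
  next
    case False
    then obtain j where "j < k" "j \<noteq> i" "j \<noteq> l" "a = u j" using as by (auto simp: addends_def)
    then have "x j = a + K *s u l" by (simp add: x_def shear_def)
    then have "a + K *s u l \<in> addends i x" using \<open>j < k\<close> \<open>j \<noteq> i\<close>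
      unfolding addends_def by (metis DiffI UnI1 image_eqI lessThan_iff singletonD)
    then show ?thesis by auto
  qed
  then obtain e where e: "e = 0 \<or> e = 1" "a + (e * K) *s u l \<in> addends i x" by blast
  define x' where "x' = shear l (\<lambda>m. if m = i then 2 * K + s * (e * K) else K) u'"
  have s: "s = 1 \<or> s = -1" using as by linarith
  have K: "K \<ge> 0" "K \<ge> K1" "K \<ge> K2" "2 * K + s * (e * K) \<ge> K2"
    using K1 K2 s e by (auto simp: K_def)
  have "x' = x(i := x i + s *s (a + (e * K) *s u l))"
    using il as by (auto simp: fun_eq_iff x_def x'_def shear_def vec_eq_iff algebra_simps)
  then have "move i x x'" using moveI[OF as(1) e(2) as(3)] by simp
  moreover have "all_big x" using K1 K il by (auto simp: all_big_def x_def shear_def)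
  moreover have "all_big x'" using K2 K il as by (auto simp: all_big_def x'_def shear_def)
  moreover have "u' l = u l" using il as by simp
  ultimately show ?thesis
    using il unfolding rep_def big_move_def x_def x'_def
    by (metis (no_types, lifting) big_move_def r_into_rtranclp)
qed

lemma big_path_of_representatives:
  assumes "pivot_move\<^sup>*\<^sup>* u u'" "rep u x" "rep u' x'"
  shows "big_move\<^sup>*\<^sup>* x x'"
  using assms
proof (induction arbitrary: x')
  case base
  then show ?case by (rule rep_unique)
next
  case (step y z)
  then obtain p q where "rep y p" "rep z q" "big_move\<^sup>*\<^sup>* p q" using pivot_move_rep by blast
  then show ?case using step rep_unique by (meson rtranclp_trans)
qed

lemma pivot_path_imp_big_path:
  assumes "pivot_move\<^sup>*\<^sup>* u u'" "all_big u" "all_big u'"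
  shows "big_move\<^sup>*\<^sup>* u u'"
proof -
  have "rep x x" if "all_big x" for x
  proof -
    have "x = shear 0 (\<lambda>_. 0) x" by (simp add: shear_def fun_eq_iff)
    moreover have "0 < k" using k_ge_3 by simp
    ultimately show ?thesis using that unfolding rep_def all_big_def by blast
  qed
  then show ?thesis using assms big_path_of_representatives by blast
qed

section \<open>Transvections as pivot paths\<close>

lemma span_path:
  assumes "i < k" "s \<in> zv.span (addends i u)"
    and R: "\<And>x y. move i x y \<Longrightarrow> (\<And>m. m \<noteq> i \<Longrightarrow> x m = u m) \<Longrightarrow> R x y"
  shows "R\<^sup>*\<^sup>* u (u(i := u i + s))"
  using assms(2)
proof (induction rule: zv.span_induct_alt)
  case base
  then show ?case by simp
next
  case (step c a y)
  have one: "R (u(i := x)) (u(i := x + s *s a))" if "\<bar>s\<bar> = 1" for x s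
  proof (rule R)
    have "move i (u(i := x)) ((u(i := x))(i := (u(i := x)) i + s *s a))"
      by (rule moveI) (use assms(1) step(1) that in auto)
    then show "move i (u(i := x)) (u(i := x + s *s a))" by simp
  qed simp
  have "R\<^sup>*\<^sup>* (u(i := x)) (u(i := x + c *s a))" for x
  proof (induction c rule: int_induct[where k = 0])
    case base
    then show ?case by simp
  next
    case (step1 c)
    have eq: "x + (c + 1) *s a = (x + c *s a) + 1 *s a" by (simp add: vec_eq_iff algebra_simps)
    show ?case unfolding eq by (rule rtranclp.rtrancl_into_rtrancl[OF step1(2)], rule one) simp
  next
    case (step2 c)
    have eq: "x + (c - 1) *s a = (x + c *s a) + (-1) *s a" by (simp add: vec_eq_iff algebra_simps)
    show ?case unfolding eq by (rule rtranclp.rtrancl_into_rtrancl[OF step2(2)], rule one) simp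
  qed
  from this[of "u i + y"] have "R\<^sup>*\<^sup>* (u(i := u i + y)) (u(i := u i + (c *s a + y)))"
    by (simp add: algebra_simps)
  with step(2) show ?case by (rule rtranclp_trans)
qed

lemma pivot_add:
  assumes "i < k" "l < k" "l \<noteq> i" "big (u l)" "s \<in> zv.span (addends i u)"
  shows "pivot_move\<^sup>*\<^sup>* u (u(i := u i + s))"
  using assms(1,5)
proof (rule span_path)
  fix x y assume "move i x y" "\<And>m. m \<noteq> i \<Longrightarrow> x m = u m"
  then show "pivot_move x y" using assms(2-4) unfolding pivot_move_def by metis
qed

lemma pivot_add_all:
  assumes "l < k" "big (u l)" "finite S" "S \<subseteq> {..<k} - {l}"
    and "\<And>i. i \<in> S \<Longrightarrow> s i \<in> zv.span (insert (u l) (set vs))"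
  shows "pivot_move\<^sup>*\<^sup>* u (\<lambda>i. if i \<in> S then u i + s i else u i)"
  using assms(3-5)
proof (induction S)
  case empty
  then show ?case by simp
next
  case (insert j S)
  let ?y = "\<lambda>i. if i \<in> S then u i + s i else u i"
  have l: "?y l = u l" using insert.prems by auto
  have eq: "(\<lambda>i. if i \<in> insert j S then u i + s i else u i) = ?y(j := ?y j + s j)"
    using insert.hyps by (auto simp: fun_eq_iff)
  have "?y l \<in> addends j ?y"
    unfolding addends_def by (rule UnI1, rule imageI) (use insert.prems assms(1) in auto)
  then have "insert (u l) (set vs) \<subseteq> addends j ?y"
    unfolding l by (auto simp: addends_def)
  then have "s j \<in> zv.span (addends j ?y)" using insert.prems zv.span_mono by blast
  then have "pivot_move\<^sup>*\<^sup>* ?y (?y(j := ?y j + s j))"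
    using insert.prems assms l by (intro pivot_add[of j l]) auto
  then show ?case unfolding eq using insert by (auto intro: rtranclp_trans)
qed

text \<open>The pivot itself may be changed if it stays big: a third entry \<open>u\<^sub>j\<close> takes over after receiving
  a large multiple of the old pivot, and this multiple is removed afterwards by means of the new
  pivot and \<open>d\<close>.\<close>

lemma pivot_change:
  assumes "l < k" "j < k" "j \<noteq> l" "big (u l)" "big (u l + d)"
    and "d \<in> zv.span (u ` ({..<k} - {l, j}) \<union> set vs)"
  shows "pivot_move\<^sup>*\<^sup>* u (u(l := u l + d))"
proof -
  obtain N where N: "big (u j + N *s u l)" using big_shift[OF assms(4), of u] assms(2) by blast
  define u1 where "u1 = u(j := u j + N *s u l)"
  define u2 where "u2 = u1(l := u l + d)"
  have "pivot_move\<^sup>*\<^sup>* u u1" unfolding u1_def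
  proof (rule pivot_add[of j l])
    have "u l \<in> addends j u" unfolding addends_def by (rule UnI1, rule imageI) (use assms in auto)
    then show "N *s u l \<in> zv.span (addends j u)" by (intro zv.span_scale zv.span_base)
  qed (use assms in auto)
  also have "pivot_move\<^sup>*\<^sup>* u1 u2"
  proof -
    have "u ` ({..<k} - {l, j}) = u1 ` ({..<k} - {l, j})" by (auto simp: u1_def)
    then have "u ` ({..<k} - {l, j}) \<union> set vs \<subseteq> addends l u1" by (auto simp: addends_def)
    then have "d \<in> zv.span (addends l u1)" using assms(6) zv.span_mono by blast
    then have "pivot_move\<^sup>*\<^sup>* u1 (u1(l := u1 l + d))"
      using assms N by (intro pivot_add[of l j]) (auto simp: u1_def)
    then show ?thesis using assms by (simp add: u2_def u1_def)
  qed
  also have "pivot_move\<^sup>*\<^sup>* u2 (u2(j := u2 j + ((- N) *s u2 l + N *s d)))"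
  proof (rule pivot_add[of j l])
    have "u ` ({..<k} - {l, j}) = u2 ` ({..<k} - {l, j})" by (auto simp: u1_def u2_def)
    then have "u ` ({..<k} - {l, j}) \<union> set vs \<subseteq> addends j u2" by (auto simp: addends_def)
    then have "d \<in> zv.span (addends j u2)" using assms(6) zv.span_mono by blast
    moreover have "u2 l \<in> addends j u2" using assms by (auto simp: addends_def)
    ultimately show "(- N) *s u2 l + N *s d \<in> zv.span (addends j u2)"
      by (intro zv.span_add zv.span_scale) (auto intro: zv.span_base)
  qed (use assms in \<open>auto simp: u2_def\<close>)
  also have "u2(j := u2 j + ((- N) *s u2 l + N *s d)) = u(l := u l + d)"
    using assms(3) by (auto simp: fun_eq_iff u2_def u1_def vec_eq_iff algebra_simps)
  finally show ?thesis .
qed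

lemma pivot_change_sum:
  assumes "l < k" "finite S" "S \<subseteq> {..<k} - {l}"
    and "\<And>T. T \<subseteq> S \<Longrightarrow> big (u l + (\<Sum>i\<in>T. g i *s u i))"
  shows "pivot_move\<^sup>*\<^sup>* u (u(l := u l + (\<Sum>i\<in>S. g i *s u i)))"
  using assms(2-4)
proof (induction S)
  case empty
  then show ?case by simp
next
  case (insert i S)
  let ?y = "u(l := u l + (\<Sum>i\<in>S. g i *s u i))"
  have il: "i < k" "i \<noteq> l" using insert.prems by auto
  obtain j where j: "j < k" "j \<noteq> i" "j \<noteq> l" using other_index by blast
  have "pivot_move\<^sup>*\<^sup>* ?y (?y(l := ?y l + g i *s u i))"
  proof (rule pivot_change[OF assms(1) j(1,3)])
    show "big (?y l)" using insert.prems(2)[of S] by auto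
    show "big (?y l + g i *s u i)"
      using insert.prems(2)[of "insert i S"] insert.hyps by (simp add: algebra_simps)
    have "?y i \<in> ?y ` ({..<k} - {l, j})" using il j by blast
    then have "u i \<in> zv.span (?y ` ({..<k} - {l, j}) \<union> set vs)"
      using il by (intro zv.span_base) simp
    then show "g i *s u i \<in> zv.span (?y ` ({..<k} - {l, j}) \<union> set vs)" by (rule zv.span_scale)
  qed
  moreover have "?y(l := ?y l + g i *s u i) = u(l := u l + (\<Sum>i\<in>insert i S. g i *s u i))"
    using insert.hyps by (simp add: algebra_simps)
  moreover have "pivot_move\<^sup>*\<^sup>* u ?y" using insert.prems by (intro insert.IH) auto
  ultimately show ?case by (metis (no_types, lifting) rtranclp_trans)
qed

definition transvect :: "int ^ 'n \<Rightarrow> (nat \<Rightarrow> int) \<Rightarrow> (nat \<Rightarrow> int ^ 'n) \<Rightarrow> nat \<Rightarrow> int ^ 'n" where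
  "transvect C f u = (\<lambda>i. if i < k then u i + f i *s C else u i)"


text \<open>
  The model is the identity of elementary matrices: adding \<open>d = \<Sum>\<^sub>i\<^sub>\<noteq>\<^sub>l c\<^sub>i u\<^sub>i\<close> to the pivot, then \<open>f\<^sub>i\<close> times
  the pivot to each other entry, and finally subtracting \<open>\<Sum>\<^sub>i\<^sub>\<noteq>\<^sub>l c\<^sub>i u\<^sub>i\<close> again, which is still \<open>d\<close>
  because \<open>f\<close> vanishes on \<open>c\<close>, adds \<open>f\<^sub>i (u\<^sub>l + d)\<close> to each \<open>u\<^sub>i\<close>. This is \<open>f\<^sub>i C\<close> up to multiples of
  the pivot \<open>u\<^sub>l\<close> and relators, which can be corrected. The pivot has to stay big throughout. To this
  end the \<open>u\<^sub>i\<close> are first replaced by \<open>y\<^sub>i = u\<^sub>i \<plusminus> N u\<^sub>l\<close>, with the sign of \<open>c\<^sub>i\<close>, so that all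
  \<open>c\<^sub>i y\<^sub>i\<close> are nonnegative; and \<open>d\<close> is subtracted in the order of the signs of \<open>c\<^sub>i f\<^sub>i\<close>, the
  negative ones first.
\<close>

lemma transvection_pivot_path:
  assumes "l < k" "big (u l)" "f l = 0" "(\<Sum>i<k. c i * f i) = 0"
    and C: "C - (\<Sum>i<k. c i *s u i) \<in> zv.span (set vs)"
  shows "pivot_move\<^sup>*\<^sup>* u (transvect C f u)"
proof -
  define S where "S = {..<k} - {l}"
  have S: "finite S" "S \<subseteq> {..<k} - {l}" "l \<notin> S" by (auto simp: S_def)
  have split: "(\<Sum>i<k. h i) = h l + (\<Sum>i\<in>S. h i)" for h :: "nat \<Rightarrow> 'x::comm_monoid_add"
    unfolding S_def using assms(1) by (intro sum.remove) auto
  obtain N where N: "\<And>i. i < k \<Longrightarrow> big (sgn (c i) *s u i + N *s u l)"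
    using big_shift[OF assms(2), of "\<lambda>i. sgn (c i) *s u i"] by blast
  define y where "y = (\<lambda>i. if i \<in> S then u i + (sgn (c i) * N) *s u l else u i)"
  have "pivot_move\<^sup>*\<^sup>* u y" unfolding y_def
    by (rule pivot_add_all[OF assms(1) _ S(1,2)]) (use assms(2) in \<open>auto intro: zv.span_scale zv.span_base\<close>)
  have yl: "y l = u l" using S by (simp add: y_def)
  have y_nonneg: "0 \<le> (c i *s y i) $ t" if "i \<in> S" for i t
  proof -
    have "0 \<le> (sgn (c i) *s u i + N *s u l) $ t"
      using N[of i] that by (intro big_nonneg) (auto simp: S_def)
    then have "0 \<le> \<bar>c i\<bar> * (sgn (c i) * u i $ t + N * u l $ t)" by simp
    also have "\<dots> = (c i *s y i) $ t"
      using that by (simp add: y_def sgn_if algebra_simps)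
    finally show ?thesis .
  qed
  define d where "d = (\<Sum>i\<in>S. c i *s y i)"
  define q where "q = u l + d"
  have part: "big (u l + (\<Sum>i\<in>T. c i *s y i))" if "T \<subseteq> S" for T
    by (rule big_add_nonneg) (use assms(2) that y_nonneg in \<open>auto intro!: sum_nonneg simp del: vector_smult_component\<close>)
  then have q: "big q" by (simp add: q_def d_def)
  have "pivot_move\<^sup>*\<^sup>* y (y(l := y l + d))"
    unfolding d_def by (rule pivot_change_sum[OF assms(1) S(1,2)]) (use part yl in simp)
  define y2 where "y2 = y(l := q)"
  have "pivot_move\<^sup>*\<^sup>* y y2"
    using \<open>pivot_move\<^sup>*\<^sup>* y (y(l := y l + d))\<close> by (simp add: y2_def q_def yl)
  define z where "z = (\<lambda>i. if i \<in> S then y2 i + f i *s q else y2 i)"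
  have "pivot_move\<^sup>*\<^sup>* y2 z" unfolding z_def
    by (rule pivot_add_all[OF assms(1) _ S(1,2)])
      (auto intro: zv.span_scale zv.span_base simp: y2_def q)
  have zl: "z l = q" using S by (simp add: z_def y2_def)
  have cz: "c i *s z i = c i *s y i + (c i * f i) *s q" if "i \<in> S" for i
    using that S by (auto simp: z_def y2_def zv.scale_right_distrib)
  have cf: "(\<Sum>i\<in>S. c i * f i) = 0" using assms(3,4) by (simp add: split)
  have sum_cz: "(\<Sum>i\<in>S. c i *s z i) = d"
  proof -
    have "(\<Sum>i\<in>S. c i *s z i) = d + (\<Sum>i\<in>S. (c i * f i) *s q)"
      by (simp add: cz d_def sum.distrib)
    also have "(\<Sum>i\<in>S. (c i * f i) *s q) = (\<Sum>i\<in>S. c i * f i) *s q"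
      by (simp add: zv.scale_sum_left)
    finally show ?thesis by (simp add: cf)
  qed
  define S1 where "S1 = {i \<in> S. 0 \<le> c i * f i}"
  define S2 where "S2 = S - S1"
  have S12: "finite S1" "finite S2" "S1 \<subseteq> {..<k} - {l}" "S2 \<subseteq> {..<k} - {l}" "l \<notin> S1" "l \<notin> S2"
    using S by (auto simp: S1_def S2_def)
  \<comment> \<open>The two halves of the subtraction meet: from \<open>z\<close> the part \<open>S2\<close> is subtracted, to \<open>z0\<close> the
    part \<open>S1\<close> is added.\<close>
  define z0 where "z0 = z(l := u l)"
  have "pivot_move\<^sup>*\<^sup>* z0 (z0(l := z0 l + (\<Sum>i\<in>S1. c i *s z0 i)))"
  proof (rule pivot_change_sum[OF assms(1) S12(1,3)])
    fix T assume T: "T \<subseteq> S1"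
    have "(\<Sum>i\<in>T. c i *s z0 i) = (\<Sum>i\<in>T. c i *s y i + (c i * f i) *s q)"
      by (rule sum.cong) (use T S12 in \<open>auto simp: z0_def S1_def cz\<close>)
    moreover have "big (u l + (\<Sum>i\<in>T. c i *s y i + (c i * f i) *s q))"
    proof (rule big_add_nonneg[OF assms(2)])
      fix t
      show "0 \<le> (\<Sum>i\<in>T. c i *s y i + (c i * f i) *s q) $ t"
        unfolding sum_component vector_add_component
        using T y_nonneg big_nonneg[OF q]
        by (intro sum_nonneg add_nonneg_nonneg) (auto simp: S1_def)
    qed
    ultimately show "big (z0 l + (\<Sum>i\<in>T. c i *s z0 i))" by (simp add: z0_def)
  qed
  moreover have "pivot_move\<^sup>*\<^sup>* z (z(l := z l + (\<Sum>i\<in>S2. (- c i) *s z i)))"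
  proof (rule pivot_change_sum[OF assms(1) S12(2,4)])
    fix T assume T: "T \<subseteq> S2"
    then have TS: "T \<subseteq> S" by (auto simp: S2_def)
    have "(\<Sum>i\<in>T. (- c i) *s z i) = (\<Sum>i\<in>T. (- (c i * f i)) *s q) - (\<Sum>i\<in>T. c i *s y i)"
      unfolding sum_subtractf[symmetric]
      by (rule sum.cong) (use TS cz in \<open>auto simp: zv.scale_minus_left\<close>)
    moreover have "d = (\<Sum>i\<in>S - T. c i *s y i) + (\<Sum>i\<in>T. c i *s y i)"
      unfolding d_def using S(1) TS by (rule sum.subset_diff[rotated])
    ultimately have "z l + (\<Sum>i\<in>T. (- c i) *s z i)
        = (u l + (\<Sum>i\<in>S - T. c i *s y i)) + (\<Sum>i\<in>T. (- (c i * f i)) *s q)"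
      by (simp add: zl q_def)
    moreover have "big \<dots>"
    proof (rule big_add_nonneg)
      fix t
      have "0 \<le> - (c i * f i) * q $ t" if "i \<in> T" for i
        using that T big_nonneg[OF q, of t]
        by (intro mult_nonneg_nonneg) (auto simp: S2_def S1_def)
      then show "0 \<le> (\<Sum>i\<in>T. (- (c i * f i)) *s q) $ t"
        unfolding sum_component vector_smult_component by (rule sum_nonneg)
    qed (use part in auto)
    ultimately show "big (z l + (\<Sum>i\<in>T. (- c i) *s z i))" by simp
  qed
  moreover have "z0(l := z0 l + (\<Sum>i\<in>S1. c i *s z0 i)) = z(l := z l + (\<Sum>i\<in>S2. (- c i) *s z i))"
  proof -
    have "(\<Sum>i\<in>S1. c i *s z0 i) = (\<Sum>i\<in>S1. c i *s z i)"
      by (rule sum.cong) (use S12 in \<open>auto simp: z0_def\<close>)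
    moreover have "d = (\<Sum>i\<in>S2. c i *s z i) + (\<Sum>i\<in>S1. c i *s z i)"
      unfolding sum_cz[symmetric] S2_def using S(1)
      by (intro sum.subset_diff) (auto simp: S1_def)
    ultimately show ?thesis
      by (simp add: z0_def zl q_def zv.scale_minus_left sum_negf)
  qed
  ultimately have "pivot_move\<^sup>*\<^sup>* z z0" by (metis pivot_move_sym rtranclp_trans)
  define r where "r = (\<lambda>i. transvect C f u i - z0 i)"
  have "pivot_move\<^sup>*\<^sup>* z0 (\<lambda>i. if i \<in> S then z0 i + r i else z0 i)"
  proof (rule pivot_add_all[OF assms(1) _ S(1,2)])
    show "big (z0 l)" by (simp add: z0_def assms)
    fix i assume i: "i \<in> S"
    define K where "K = (\<Sum>i\<in>S. c i * (sgn (c i) * N))"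
    have "d = (\<Sum>i\<in>S. c i *s u i + (c i * (sgn (c i) * N)) *s u l)"
      unfolding d_def by (rule sum.cong) (auto simp: y_def zv.scale_right_distrib)
    then have d: "d = (\<Sum>i\<in>S. c i *s u i) + K *s u l"
      by (simp add: sum.distrib K_def zv.scale_sum_left)
    have "r i = f i *s (C - (\<Sum>i<k. c i *s u i)) + (f i * (c l - K - 1) - sgn (c i) * N) *s u l"
      using i S
      by (auto simp: r_def transvect_def z0_def z_def y2_def y_def q_def d split S_def vec_eq_iff algebra_simps)
    moreover have "C - (\<Sum>i<k. c i *s u i) \<in> zv.span (insert (u l) (set vs))"
      using C zv.span_mono[of "set vs" "insert (u l) (set vs)"] by blast
    ultimately show "r i \<in> zv.span (insert (z0 l) (set vs))"
      by (simp add: z0_def) (intro zv.span_add zv.span_scale, auto intro: zv.span_base)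
  qed
  moreover have "(\<lambda>i. if i \<in> S then z0 i + r i else z0 i) = transvect C f u"
    using S assms(3) by (auto simp: fun_eq_iff r_def S_def z0_def z_def y2_def y_def transvect_def)
  ultimately show ?thesis
    using \<open>pivot_move\<^sup>*\<^sup>* u y\<close> \<open>pivot_move\<^sup>*\<^sup>* y y2\<close> \<open>pivot_move\<^sup>*\<^sup>* y2 z\<close> \<open>pivot_move\<^sup>*\<^sup>* z z0\<close>
    by (metis (no_types, lifting) rtranclp_trans)
qed

text \<open>The difference \<open>g - f\<close> vanishes on the pivot, and \<open>c\<close> are still coordinates of \<open>C\<close> in the
  transvected tuple.\<close>

lemma transvection_change:
  assumes "l < k" "big (transvect C f u l)" "g l = f l"
    and "(\<Sum>i<k. c i * f i) = 0" "(\<Sum>i<k. c i * g i) = 0"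
    and C: "C - (\<Sum>i<k. c i *s u i) \<in> zv.span (set vs)"
  shows "pivot_move\<^sup>*\<^sup>* (transvect C f u) (transvect C g u)"
proof -
  have "(\<Sum>i<k. c i *s transvect C f u i) = (\<Sum>i<k. c i *s u i + (c i * f i) *s C)"
    by (rule sum.cong) (auto simp: transvect_def zv.scale_right_distrib)
  also have "\<dots> = (\<Sum>i<k. c i *s u i) + (\<Sum>i<k. c i * f i) *s C"
    by (simp add: sum.distrib zv.scale_sum_left)
  finally have eq: "(\<Sum>i<k. c i *s transvect C f u i) = (\<Sum>i<k. c i *s u i)"
    using assms by simp
  have "pivot_move\<^sup>*\<^sup>* (transvect C f u) (transvect C (\<lambda>i. g i - f i) (transvect C f u))"
    by (rule transvection_pivot_path[where c = c])
      (use assms in \<open>auto simp: eq right_diff_distrib sum_subtractf\<close>)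
  also have "transvect C (\<lambda>i. g i - f i) (transvect C f u) = transvect C g u"
    by (auto simp: transvect_def fun_eq_iff zv.scale_left_diff_distrib)
  finally show ?thesis .
qed

text \<open>Supplies the functional that replaces \<open>f\<close>, with a prescribed value at a second index \<open>m\<close>: zero
  for \<open>e = 0\<close>, positive for \<open>e = 1\<close> and \<open>D > 0\<close>. A third index \<open>j\<close> with \<open>c\<^sub>j \<noteq> 0\<close> balances the sum; solving
  for \<open>g\<^sub>j\<close> divides by \<open>c\<^sub>j\<close>, hence the factor in the divisibility of \<open>f\<^sub>l\<close>.\<close>

lemma orthogonal_functional:
  fixes c f :: "nat \<Rightarrow> int"
  assumes "\<exists>i<k. c i \<noteq> 0" "(\<Sum>i<k. c i * f i) = 0" "l < k" "f l > 0"
    and "D * (\<Prod>i<k. if c i = 0 then 1 else c i) dvd f l"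
  shows "\<exists>g m. m < k \<and> m \<noteq> l \<and> g l = f l \<and> (\<Sum>i<k. c i * g i) = 0 \<and> (\<forall>i<k. D dvd g i) \<and>
    (\<exists>b\<ge>1. g m = D * b * e)"
proof -
  have "\<exists>j<k. j \<noteq> l \<and> c j \<noteq> 0"
  proof (rule ccontr)
    assume *: "\<not> ?thesis"
    have "(\<Sum>i<k. c i * f i) = c l * f l + (\<Sum>i\<in>{..<k} - {l}. c i * f i)"
      using assms by (intro sum.remove) auto
    also have "(\<Sum>i\<in>{..<k} - {l}. c i * f i) = 0" using * by (intro sum.neutral) auto
    finally show False using assms * by auto
  qed
  then obtain j where j: "j < k" "j \<noteq> l" "c j \<noteq> 0" by blast
  have "(if c j = 0 then 1 else c j) dvd (\<Prod>i<k. if c i = 0 then 1 else c i)"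
    using j by (intro dvd_prodI) auto
  then have "D * c j dvd f l" using j assms(5) by (auto intro: dvd_trans mult_dvd_mono)
  then obtain f' where f': "f l = D * c j * f'" by (elim dvdE)
  obtain m where m: "m < k" "m \<noteq> l" "m \<noteq> j" using other_index by blast
  define g where "g = (\<lambda>i. if i = l then f l else if i = m then D * \<bar>c j\<bar> * e
    else if i = j then - D * (c l * f' + c m * sgn (c j) * e) else 0)"
  have "(\<Sum>i<k. c i * g i) = (\<Sum>i\<in>{l, m, j}. c i * g i)"
    by (rule sum.mono_neutral_right) (use assms j m in \<open>auto simp: g_def\<close>)
  also have "\<dots> = c l * f l + c m * (D * \<bar>c j\<bar> * e) - c j * (D * (c l * f' + c m * sgn (c j) * e))"
    using j m by (simp add: g_def)
  also have "\<dots> = 0" by (simp add: f' sgn_if algebra_simps)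
  finally have "(\<Sum>i<k. c i * g i) = 0" .
  moreover have "\<forall>i<k. D dvd g i" by (auto simp: g_def f')
  moreover have "g l = f l" by (simp add: g_def)
  moreover have "g m = D * \<bar>c j\<bar> * e" "\<bar>c j\<bar> \<ge> 1" using m j by (auto simp: g_def)
  ultimately show ?thesis using m by blast
qed

lemma sum_eq_two:
  fixes F G :: "nat \<Rightarrow> 'x::ab_group_add"
  assumes "i < k" "j < k" "i \<noteq> j" "\<And>m. m \<noteq> i \<Longrightarrow> m \<noteq> j \<Longrightarrow> F m = G m" "F i + F j = G i + G j"
  shows "(\<Sum>m<k. F m) = (\<Sum>m<k. G m)"
proof -
  have "(\<Sum>m<k. h m) = h i + h j + (\<Sum>m\<in>{..<k} - {i} - {j}. h m)" for h :: "nat \<Rightarrow> 'x"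
    using assms by (simp add: sum.remove[of "{..<k}" i] sum.remove[of "{..<k} - {i}" j] add.assoc)
  moreover have "(\<Sum>m\<in>{..<k} - {i} - {j}. F m) = (\<Sum>m\<in>{..<k} - {i} - {j}. G m)"
    using assms by (intro sum.cong) auto
  ultimately show ?thesis using assms(5) by simp
qed

section \<open>Transporting a path of moves by transvections\<close>

text \<open>Coordinates and functionals change contragrediently under a move, so a move of tuples is also a
  move of the transvected tuples.\<close>

lemma move_coordinates:
  assumes "move i u u'" "\<exists>i<k. c i \<noteq> 0" "C - (\<Sum>i<k. c i *s u i) \<in> zv.span (set vs)"
  shows "\<exists>c'. (\<exists>i<k. c' i \<noteq> 0) \<and> C - (\<Sum>i<k. c' i *s u' i) \<in> zv.span (set vs) \<and>
    (\<forall>f. \<exists>f'. (\<Sum>i<k. c' i * f' i) = (\<Sum>i<k. c i * f i) \<and>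
      (\<forall>D. (\<forall>i<k. D dvd f i) \<longrightarrow> (\<forall>i<k. D dvd f' i)) \<and> (\<forall>m. m \<noteq> i \<longrightarrow> f' m = f m) \<and>
      move i (transvect C f u) (transvect C f' u'))"
proof -
  obtain a s where as: "i < k" "a \<in> addends i u" "\<bar>s\<bar> = 1" "u' = u(i := u i + s *s a)"
    using assms unfolding move_def by blast
  consider "a \<in> set vs" | j where "j < k" "j \<noteq> i" "a = u j" using as by (auto simp: addends_def)
  then show ?thesis
  proof cases
    case 1
    have "(\<Sum>m<k. c m *s u' m) = c i *s u' i + (\<Sum>m\<in>{..<k} - {i}. c m *s u' m)"
      using as by (intro sum.remove) auto
    also have "(\<Sum>m\<in>{..<k} - {i}. c m *s u' m) = (\<Sum>m\<in>{..<k} - {i}. c m *s u m)"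
      using as by (intro sum.cong) auto
    also have "c i *s u' i + \<dots> = (c i * s) *s a + (c i *s u i + \<dots>)"
      using as by (simp add: zv.scale_right_distrib)
    also have "c i *s u i + (\<Sum>m\<in>{..<k} - {i}. c m *s u m) = (\<Sum>m<k. c m *s u m)"
      using as by (intro sum.remove[symmetric]) auto
    finally have "C - (\<Sum>m<k. c m *s u' m) = (C - (\<Sum>m<k. c m *s u m)) - (c i * s) *s a"
      by simp
    also have "\<dots> \<in> zv.span (set vs)"
      by (rule zv.span_diff[OF assms(3) zv.span_scale[OF zv.span_base[OF 1]]])
    finally have "C - (\<Sum>m<k. c m *s u' m) \<in> zv.span (set vs)" .
    moreover have "move i (transvect C f u) (transvect C f u')" for f
    proof -
      have "transvect C f u' = (transvect C f u)(i := transvect C f u i + s *s a)"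
        using as by (auto simp: fun_eq_iff transvect_def)
      then show ?thesis using 1 as by (auto simp: addends_def intro!: moveI)
    qed
    ultimately show ?thesis using assms(2) by blast
  next
    case (2 j)
    let ?c = "c(j := c j - s * c i)"
    have "(\<Sum>m<k. ?c m *s u' m) = (\<Sum>m<k. c m *s u m)"
      by (rule sum_eq_two[of i j]) (use 2 as in \<open>auto simp: vec_eq_iff algebra_simps\<close>)
    then have "C - (\<Sum>m<k. ?c m *s u' m) \<in> zv.span (set vs)" using assms(3) by simp
    moreover have "\<exists>m<k. ?c m \<noteq> 0"
    proof (rule ccontr)
      assume "\<not> ?thesis"
      then have *: "?c m = 0" if "m < k" for m using that by blast
      have "c i = 0" using *[of i] 2 as by simp
      then have "c m = 0" if "m < k" for m using *[of m] that by (cases "m = j") auto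
      then show False using assms(2) by blast
    qed
    moreover have "\<exists>f'. (\<Sum>m<k. ?c m * f' m) = (\<Sum>m<k. c m * f m) \<and>
      (\<forall>D. (\<forall>i<k. D dvd f i) \<longrightarrow> (\<forall>i<k. D dvd f' i)) \<and> (\<forall>m. m \<noteq> i \<longrightarrow> f' m = f m) \<and>
      move i (transvect C f u) (transvect C f' u')" for f
    proof (intro exI conjI)
      let ?f = "f(i := f i + s * f j)"
      show "(\<Sum>m<k. ?c m * ?f m) = (\<Sum>m<k. c m * f m)"
        by (rule sum_eq_two[of i j]) (use 2 as in \<open>auto simp: algebra_simps\<close>)
      show "\<forall>D. (\<forall>i<k. D dvd f i) \<longrightarrow> (\<forall>i<k. D dvd ?f i)" using 2 as by auto
      show "\<forall>m. m \<noteq> i \<longrightarrow> ?f m = f m" by simp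
      have "transvect C ?f u' = (transvect C f u)(i := transvect C f u i + s *s transvect C f u j)"
        using as 2 by (auto simp: fun_eq_iff transvect_def vec_eq_iff algebra_simps)
      moreover have "transvect C f u j \<in> addends i (transvect C f u)"
        using 2 by (auto simp: addends_def)
      ultimately show "move i (transvect C f u) (transvect C ?f u')"
        using as by (auto intro!: moveI)
    qed
    ultimately show ?thesis by blast
  qed
qed

text \<open>
  Induction from the end of the path. Let a move change the entry at \<open>i\<close>. If some other entry has
  \<open>f\<^sub>l > 0\<close>, it is big after the transvection and serves as the pivot. Otherwise \<open>f\<^sub>i > 0\<close>, and with \<open>i\<close>
  as the pivot \<open>f\<close> is exchanged for a functional that is positive elsewhere. At the end, with \<open>l\<close> as
  the pivot, \<open>f\<close> is exchanged for a functional \<open>g\<close> with \<open>g\<^sub>m = 0\<close> for some \<open>m \<noteq> l\<close>; then \<open>w\<^sub>m\<close>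
  appears unchanged, and with this pivot \<open>g\<close> is exchanged for \<open>0\<close>.
\<close>

lemma transvected_path:
  assumes "(\<lambda>u u'. \<exists>i. move i u u')\<^sup>*\<^sup>* u w" "all_big w" "big C"
    and "\<exists>i<k. c i \<noteq> 0" "C - (\<Sum>i<k. c i *s u i) \<in> zv.span (set vs)"
  shows "\<exists>D>0. \<forall>f. (\<forall>i<k. D dvd f i) \<longrightarrow> (\<Sum>i<k. c i * f i) = 0 \<longrightarrow> (\<exists>l<k. f l > 0) \<longrightarrow>
    pivot_move\<^sup>*\<^sup>* (transvect C f u) w"
  using assms(1,4,5)
proof (induction arbitrary: c rule: converse_rtranclp_induct)
  case base
  let ?E = "\<Prod>i<k. if c i = 0 then 1 else c i"
  obtain K where K: "K \<ge> 0" "\<And>i N. i < k \<Longrightarrow> N \<ge> K \<Longrightarrow> big (w i + N *s C)"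
    using big_shift[OF assms(3), of w] by blast
  show ?case
  proof (intro exI[of _ "(K + 1) * \<bar>?E\<bar>"] conjI allI impI)
    have "?E \<noteq> 0" by simp
    then show "0 < (K + 1) * \<bar>?E\<bar>" using K by (intro mult_pos_pos) (auto simp del: prod_zero_iff)
    fix f assume f: "\<forall>i<k. (K + 1) * \<bar>?E\<bar> dvd f i" "(\<Sum>i<k. c i * f i) = 0" "\<exists>l<k. f l > 0"
    then obtain l where l: "l < k" "f l > 0" by blast
    have "(K + 1) * ?E dvd (K + 1) * \<bar>?E\<bar>" by (rule mult_dvd_mono) auto
    then have dv: "(K + 1) * ?E dvd f l" using f(1)[rule_format, OF l(1)] by (rule dvd_trans)
    then have "K + 1 dvd f l" by (rule dvd_mult_left)
    then have "f l \<ge> K" using zdvd_imp_le[of "K + 1" "f l"] l(2) by linarith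
    then have big_l: "big (transvect C f w l)" using K l by (simp add: transvect_def)
    obtain g m where g: "m < k" "m \<noteq> l" "g l = f l" "(\<Sum>i<k. c i * g i) = 0" "g m = 0"
      using orthogonal_functional[OF base(1) f(2) l dv, of 0] by auto
    have "pivot_move\<^sup>*\<^sup>* (transvect C f w) (transvect C g w)"
      using transvection_change[OF l(1) big_l g(3) f(2) g(4) base(2)] .
    also have "pivot_move\<^sup>*\<^sup>* (transvect C g w) (transvect C (\<lambda>_. 0) w)"
      by (rule transvection_change[of m _ _ _ _ c])
        (use g base assms(2) in \<open>auto simp: transvect_def all_big_def\<close>)
    also have "transvect C (\<lambda>_. 0) w = w" by (simp add: transvect_def fun_eq_iff)
    finally show "pivot_move\<^sup>*\<^sup>* (transvect C f w) w" .
  qed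
next
  case (step u u')
  obtain i where i: "move i u u'" using step by blast
  obtain c' where c': "\<exists>i<k. c' i \<noteq> 0" "C - (\<Sum>i<k. c' i *s u' i) \<in> zv.span (set vs)"
    and follow: "\<And>f. \<exists>f'. (\<Sum>i<k. c' i * f' i) = (\<Sum>i<k. c i * f i) \<and>
      (\<forall>D. (\<forall>i<k. D dvd f i) \<longrightarrow> (\<forall>i<k. D dvd f' i)) \<and> (\<forall>m. m \<noteq> i \<longrightarrow> f' m = f m) \<and>
      move i (transvect C f u) (transvect C f' u')"
    using move_coordinates[OF i step.prems] by blast
  obtain D where D: "D > 0" "\<And>f. \<lbrakk>\<forall>i<k. D dvd f i; (\<Sum>i<k. c' i * f i) = 0; \<exists>l<k. f l > 0\<rbrakk> \<Longrightarrow>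
    pivot_move\<^sup>*\<^sup>* (transvect C f u') w"
    using step.IH[OF c'] by blast
  let ?E = "\<Prod>i<k. if c i = 0 then 1 else c i"
  obtain K where K: "K \<ge> 0" "\<And>i N. i < k \<Longrightarrow> N \<ge> K \<Longrightarrow> big (u i + N *s C)"
    using big_shift[OF assms(3), of u] by blast
  let ?D = "D * (K + 1)"
  have big_l: "big (transvect C f u l)" if "\<forall>i<k. ?D dvd f i" "l < k" "f l > 0" for f l
  proof -
    have "K + 1 dvd f l" using that(1)[rule_format, OF that(2)] by (rule dvd_mult_right)
    then have "f l \<ge> K" using zdvd_imp_le[of "K + 1" "f l"] that(3) by linarith
    then show ?thesis using K that by (simp add: transvect_def)
  qed
  have other: "pivot_move\<^sup>*\<^sup>* (transvect C f u) w"
    if f: "\<forall>i<k. ?D dvd f i" "(\<Sum>i<k. c i * f i) = 0" "l < k" "f l > 0" "l \<noteq> i" for f l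
  proof -
    obtain f' where f': "(\<Sum>i<k. c' i * f' i) = (\<Sum>i<k. c i * f i)"
      "(\<forall>i<k. D dvd f i) \<longrightarrow> (\<forall>i<k. D dvd f' i)" "\<forall>m. m \<noteq> i \<longrightarrow> f' m = f m"
      "move i (transvect C f u) (transvect C f' u')"
      using follow[of f] by blast
    have "pivot_move (transvect C f u) (transvect C f' u')"
      unfolding pivot_move_def using f'(4) f(3,5) big_l[OF f(1,3,4)] by blast
    moreover have "pivot_move\<^sup>*\<^sup>* (transvect C f' u') w"
    proof (rule D(2))
      have "\<forall>i<k. D dvd f i" using f(1) by (metis dvd_mult_left)
      then show "\<forall>i<k. D dvd f' i" using f'(2) by blast
      show "(\<Sum>i<k. c' i * f' i) = 0" using f'(1) f(2) by simp
      show "\<exists>l<k. 0 < f' l" using f(3,4,5) f'(3) by auto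
    qed
    ultimately show ?thesis by (rule converse_rtranclp_into_rtranclp)
  qed
  show ?case
  proof (intro exI[of _ "?D * \<bar>?E\<bar>"] conjI allI impI)
    have "?E \<noteq> 0" by simp
    then show "0 < ?D * \<bar>?E\<bar>" using K D by (intro mult_pos_pos) (auto simp del: prod_zero_iff)
    fix f assume f: "\<forall>i<k. ?D * \<bar>?E\<bar> dvd f i" "(\<Sum>i<k. c i * f i) = 0" "\<exists>l<k. f l > 0"
    then have fD: "\<forall>i<k. ?D dvd f i" by (metis dvd_mult_left)
    obtain l where l: "l < k" "f l > 0" using f by blast
    show "pivot_move\<^sup>*\<^sup>* (transvect C f u) w"
    proof (cases "l = i")
      case False
      then show ?thesis by (rule other[OF fD f(2) l])
    next
      case True
      have "?D * ?E dvd ?D * \<bar>?E\<bar>" by (rule mult_dvd_mono) auto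
      then have dv: "?D * ?E dvd f l" using f(1)[rule_format, OF l(1)] by (rule dvd_trans)
      obtain g m b where g: "m < k" "m \<noteq> l" "g l = f l" "(\<Sum>i<k. c i * g i) = 0"
        "\<forall>i<k. ?D dvd g i" "b \<ge> 1" "g m = ?D * b * 1"
        using orthogonal_functional[OF step.prems(1) f(2) l dv, of 1] by blast
      have "pivot_move\<^sup>*\<^sup>* (transvect C f u) (transvect C g u)"
        using transvection_change[OF l(1) big_l[OF fD l] g(3) f(2) g(4) step.prems(2)] .
      also have "pivot_move\<^sup>*\<^sup>* (transvect C g u) w"
      proof (rule other[OF g(5,4,1)])
        show "0 < g m" using g K D by (auto intro!: mult_pos_pos)
      qed (use g True in simp)
      finally show ?thesis .
    qed
  qed
qed

text \<open>The functional \<open>D e\<^sub>1\<close> vanishes on \<open>C = w\<^sub>0\<close>, and its transvection adds a multiple of the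
  pivot \<open>w\<^sub>0\<close>.\<close>

lemma move_path_imp_big_path:
  assumes "(\<lambda>u u'. \<exists>i. move i u u')\<^sup>*\<^sup>* w w'" "all_big w" "all_big w'"
  shows "big_move\<^sup>*\<^sup>* w w'"
proof (rule pivot_path_imp_big_path[OF _ assms(2,3)])
  let ?c = "\<lambda>i. if i = 0 then 1 else 0 :: int"
  have k: "0 < k" "1 < k" using k_ge_3 by auto
  have big0: "big (w 0)" using assms k by (auto simp: all_big_def)
  have "(\<Sum>i<k. ?c i *s w i) = (\<Sum>i\<in>{0}. ?c i *s w i)"
    by (rule sum.mono_neutral_right) (use k in auto)
  then have "w 0 - (\<Sum>i<k. ?c i *s w i) \<in> zv.span (set vs)" by (simp add: zv.span_zero)
  moreover have "\<exists>i<k. ?c i \<noteq> 0" using k by auto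
  ultimately obtain D where D: "D > 0" "\<And>f. \<lbrakk>\<forall>i<k. D dvd f i; (\<Sum>i<k. ?c i * f i) = 0; \<exists>l<k. f l > 0\<rbrakk> \<Longrightarrow>
    pivot_move\<^sup>*\<^sup>* (transvect (w 0) f w) w'"
    using transvected_path[OF assms(1,3) big0, of ?c] by blast
  define f where "f = (\<lambda>i. if i = (1::nat) then D else 0 :: int)"
  have "(\<Sum>i<k. ?c i * f i) = 0" by (intro sum.neutral) (auto simp: f_def)
  then have "pivot_move\<^sup>*\<^sup>* (transvect (w 0) f w) w'"
    using D(1) k by (intro D(2)) (auto simp: f_def)
  moreover have "pivot_move\<^sup>*\<^sup>* w (w(1 := w 1 + D *s w 0))"
  proof (rule pivot_add[of 1 0])
    have "w 0 \<in> addends 1 w" unfolding addends_def by (rule UnI1, rule imageI) (use k in auto)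
    then show "D *s w 0 \<in> zv.span (addends 1 w)" by (intro zv.span_scale zv.span_base)
  qed (use k big0 in auto)
  moreover have "w(1 := w 1 + D *s w 0) = transvect (w 0) f w"
    using k by (auto simp: fun_eq_iff transvect_def f_def)
  ultimately show "pivot_move\<^sup>*\<^sup>* w w'" by (metis rtranclp_trans)
qed


section \<open>Lists and classes in the quotient\<close>

lemma move_sign_cases:
  assumes "\<bar>s :: int\<bar> = 1"
  shows "s *s x = x \<or> s *s x = - x"
proof -
  have "s = 1 \<or> s = - 1" using assms by linarith
  then show ?thesis by (auto simp: vec_eq_iff)
qed

lemma big_move_imp_big_step:
  assumes "big_move u u'"
  shows "big_step M vs (map u [0..<k]) (map u' [0..<k])"
proof -
  obtain i where b: "all_big u" "all_big u'" and i: "move i u u'"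
    using assms unfolding big_move_def by blast
  then obtain a s where as: "i < k" "a \<in> addends i u" "\<bar>s\<bar> = 1" "u' = u(i := u i + s *s a)"
    unfolding move_def by blast
  have upd: "map u' [0..<k] = (map u [0..<k])[i := u i + s *s a]"
    by (rule nth_equalityI) (auto simp: as nth_list_update)
  have "M_big M (map u [0..<k])" "M_big M (map u' [0..<k])"
    using b by (auto simp: M_big_def all_big_def big_def)
  moreover consider "a \<in> set vs" | j where "j < k" "j \<noteq> i" "a = u j"
    using as by (auto simp: addends_def)
  then have "nielsen_move Zn (map u [0..<k]) (map u' [0..<k]) \<or>
    nielsen_move_rel Zn vs (map u [0..<k]) (map u' [0..<k])"
  proof cases
    case 1
    then obtain j where "j < length vs" "a = vs ! j" by (auto simp: in_set_conv_nth)
    moreover have "map u' [0..<k] = (map u [0..<k])[i := map u [0..<k] ! i \<otimes>\<^bsub>Zn\<^esub> a] \<or>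
      map u' [0..<k] = (map u [0..<k])[i := map u [0..<k] ! i \<otimes>\<^bsub>Zn\<^esub> inv\<^bsub>Zn\<^esub> a]"
      using as(1) move_sign_cases[OF as(3), of a] unfolding upd inv_Zn by (auto simp: Zn_def)
    moreover have "i < length (map u [0..<k])" using as(1) by simp
    ultimately show ?thesis unfolding nielsen_move_rel_def by blast
  next
    case (2 j)
    then have "map u' [0..<k] = (map u [0..<k])[i := map u [0..<k] ! i \<otimes>\<^bsub>Zn\<^esub> map u [0..<k] ! j] \<or>
      map u' [0..<k] = (map u [0..<k])[i := map u [0..<k] ! i \<otimes>\<^bsub>Zn\<^esub> inv\<^bsub>Zn\<^esub> (map u [0..<k] ! j)]"
      using as(1) move_sign_cases[OF as(3), of a] unfolding upd inv_Zn by (auto simp: Zn_def)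
    moreover have "i < length (map u [0..<k])" "j < length (map u [0..<k])" using as(1) 2 by auto
    ultimately show ?thesis unfolding nielsen_move_def using 2 by blast
  qed
  ultimately show ?thesis unfolding big_step_def by blast
qed

lemma big_path_imp_big_step_path:
  "big_move\<^sup>*\<^sup>* u u' \<Longrightarrow> (big_step M vs)\<^sup>*\<^sup>* (map u [0..<k]) (map u' [0..<k])"
  by (induction rule: rtranclp_induct) (auto intro: rtranclp.rtrancl_into_rtrancl big_move_imp_big_step)

lemma move_path_upd:
  assumes "i < k" "s \<in> zv.span (addends i u)"
  shows "(\<lambda>u u'. \<exists>i. move i u u')\<^sup>*\<^sup>* u (u(i := u i + s))"
  using assms by (rule span_path) blast

end

lemma generate_Zn: "generate Zn S = zv.span (S :: (int ^ 'n) set)"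
proof
  show "generate Zn S \<subseteq> zv.span S"
  proof
    fix x assume "x \<in> generate Zn S"
    then show "x \<in> zv.span S"
      by induction
        (auto simp: inv_Zn intro: zv.span_neg zv.span_base, auto simp: Zn_def intro: zv.span_zero zv.span_add)
  qed
  have add: "x + y \<in> generate Zn S" if "x \<in> generate Zn S" "y \<in> generate Zn S" for x y
    using generate.eng[OF that] by (simp add: Zn_def)
  have zero: "0 \<in> generate Zn S" using generate.one[of Zn S] by (simp add: Zn_def)
  have neg: "- a \<in> generate Zn S" if "a \<in> S" for a
    using generate.inv[OF that, of Zn] by (simp add: inv_Zn)
  have scale: "c *s a \<in> generate Zn S" if "a \<in> S" for c :: int and a
  proof (induction c rule: int_induct[where k = 0])
    case base
    then show ?case by (simp add: zero)
  next
    case (step1 c)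
    then show ?case using add[OF _ generate.incl[OF that]] by (simp add: zv.scale_left_distrib)
  next
    case (step2 c)
    then show ?case using add[OF _ neg[OF that]] by (simp add: zv.scale_left_diff_distrib)
  qed
  show "zv.span S \<subseteq> generate Zn S"
  proof
    fix x assume "x \<in> zv.span S"
    then show "x \<in> generate Zn S"
      by (induction rule: zv.span_induct_alt) (auto intro: zero add scale)
  qed
qed

lemma quot_class_eq_iff:
  "quot_class vs x = quot_class vs y \<longleftrightarrow> x - y \<in> zv.span (set vs)"
proof -
  interpret comm_group "Zn :: (int ^ 'n) monoid" by (rule comm_group_Zn)
  have H: "subgroup (generate Zn (set vs)) Zn" by (rule generate_is_subgroup) (simp add: Zn_def)
  have mem: "x \<in> quot_class vs y \<longleftrightarrow> x - y \<in> zv.span (set vs)" for x y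
  proof -
    have "x \<in> quot_class vs y \<longleftrightarrow> (\<exists>h \<in> zv.span (set vs). x = h + y)"
      by (simp add: quot_class_def r_coset_def generate_Zn) (simp add: Zn_def)
    also have "\<dots> \<longleftrightarrow> x - y \<in> zv.span (set vs)"
      by (auto intro!: bexI[of _ "x - y"])
    finally show ?thesis .
  qed
  have "x \<in> quot_class vs x" by (simp add: mem zv.span_zero)
  then show ?thesis using mem repr_independence[OF _ _ H, of x y] unfolding quot_class_def
    by (auto simp: Zn_def)
qed

lemma quot_class_add:
  "quot_class vs x \<otimes>\<^bsub>quot_A ws vs\<^esub> quot_class vs y = quot_class vs (x + y)"
proof -
  interpret comm_group "Zn :: (int ^ 'n) monoid" by (rule comm_group_Zn)
  have "generate Zn (set vs) \<lhd> Zn"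
    by (intro subgroup_imp_normal generate_is_subgroup) (simp add: Zn_def)
  from normal.rcos_sum[OF this, of x y] show ?thesis
    by (simp add: quot_class_def quot_A_def FactGroup_def set_mult_def Zn_def)
qed

lemma quot_class_minus:
  assumes "x \<in> zv.span (set vs \<union> set ws)"
  shows "inv\<^bsub>quot_A ws vs\<^esub> quot_class vs x = quot_class vs (- x)"
proof -
  interpret Q: comm_group "quot_A ws vs" by (rule comm_group_quot_A)
  have "\<one>\<^bsub>quot_A ws vs\<^esub> = quot_class vs 0"
    by (simp add: quot_A_def quot_class_def FactGroup_def r_coset_def Zn_def)
  then have "quot_class vs (- x) \<otimes>\<^bsub>quot_A ws vs\<^esub> quot_class vs x = \<one>\<^bsub>quot_A ws vs\<^esub>"
    by (simp add: quot_class_add)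
  then show ?thesis
    using assms by (intro Q.inv_equality quot_class_in_carrier) (auto simp: generate_Zn zv.span_neg)
qed

lemma span_insert_add:
  fixes a s :: "int ^ 'n"
  assumes "s \<in> zv.span R"
  shows "zv.span (insert (a + s) R) = zv.span (insert a R)"
proof -
  have "x - c *s (a + s) \<in> zv.span R \<longleftrightarrow> x - c *s a \<in> zv.span R" for x c
  proof -
    have "x - c *s (a + s) = (x - c *s a) + (- c) *s s"
      by (simp add: vec_eq_iff algebra_simps)
    then show ?thesis by (simp only: zv.span_add_eq2[OF zv.span_scale[OF assms]])
  qed
  then show ?thesis by (simp add: set_eq_iff zv.span_breakdown_eq)
qed

lemma span_update:
  fixes xs vs :: "(int ^ 'n) list"
  assumes "i < length xs" "s \<in> zv.span (set vs \<union> {xs ! j | j. j < length xs \<and> j \<noteq> i})"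
  shows "zv.span (set vs \<union> set (xs[i := xs ! i + s])) = zv.span (set vs \<union> set xs)"
proof -
  let ?R = "set vs \<union> {xs ! j | j. j < length xs \<and> j \<noteq> i}"
  have "set vs \<union> set xs = insert (xs ! i) ?R"
    using assms(1) by (auto simp: set_conv_nth)
  moreover have "set vs \<union> set (xs[i := xs ! i + s]) = insert (xs ! i + s) ?R"
    using assms(1) by (auto simp: set_conv_nth nth_list_update)
  ultimately show ?thesis using span_insert_add[OF assms(2)] by simp
qed

lemma big_step_path_imp_nielsen_equivalent:
  assumes "(big_step M vs)\<^sup>*\<^sup>* ws xs"
  shows "zv.span (set vs \<union> set xs) = zv.span (set vs \<union> set ws) \<and>
    nielsen_equivalent (quot_A ws vs) (map (quot_class vs) ws) (map (quot_class vs) xs)"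
  using assms
proof induction
  case base
  then show ?case by (simp add: nielsen_equivalent_def)
next
  case (step xs ys)
  let ?Q = "quot_A ws vs" and ?cl = "quot_class vs"
  have "nielsen_move Zn xs ys \<or> nielsen_move_rel Zn vs xs ys"
    using step.hyps(2) by (simp add: big_step_def)
  then show ?case
  proof
    assume "nielsen_move Zn xs ys"
    then obtain i j where ij: "i < length xs" "j < length xs" "j \<noteq> i"
      and "ys = xs[i := xs ! i + xs ! j] \<or> ys = xs[i := xs ! i + - (xs ! j)]"
      unfolding nielsen_move_def inv_Zn by (auto simp: Zn_def)
    then obtain s where ys: "ys = xs[i := xs ! i + s]" and s: "s = xs ! j \<or> s = - (xs ! j)"
      by blast
    have "xs ! j \<in> zv.span (set vs \<union> {xs ! j | j. j < length xs \<and> j \<noteq> i})"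
      by (rule zv.span_base) (use ij in auto)
    then have "s \<in> zv.span (set vs \<union> {xs ! j | j. j < length xs \<and> j \<noteq> i})"
      using s by (auto intro: zv.span_neg)
    then have sp: "zv.span (set vs \<union> set ys) = zv.span (set vs \<union> set ws)"
      using span_update[OF ij(1)] step.IH unfolding ys by simp
    have "xs ! j \<in> zv.span (set vs \<union> set xs)"
      by (rule zv.span_base) (use ij in simp)
    then have inv: "inv\<^bsub>?Q\<^esub> ?cl (xs ! j) = ?cl (- (xs ! j))"
      using step.IH by (intro quot_class_minus) simp
    have "map ?cl ys = (map ?cl xs)[i := ?cl (xs ! i) \<otimes>\<^bsub>?Q\<^esub> ?cl (xs ! j)] \<or>
      map ?cl ys = (map ?cl xs)[i := ?cl (xs ! i) \<otimes>\<^bsub>?Q\<^esub> inv\<^bsub>?Q\<^esub> ?cl (xs ! j)]"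
      using s unfolding ys map_update inv quot_class_add by blast
    moreover have "map ?cl xs ! i = ?cl (xs ! i)" "map ?cl xs ! j = ?cl (xs ! j)"
      "i < length (map ?cl xs)" "j < length (map ?cl xs)" using ij by auto
    ultimately have "nielsen_move ?Q (map ?cl xs) (map ?cl ys)"
      unfolding nielsen_move_def using ij(3) by metis
    then show ?case
      using step.IH sp unfolding nielsen_equivalent_def
      by (blast intro: rtranclp.rtrancl_into_rtrancl)
  next
    assume "nielsen_move_rel Zn vs xs ys"
    then obtain i j where ij: "i < length xs" "j < length vs"
      and "ys = xs[i := xs ! i + vs ! j] \<or> ys = xs[i := xs ! i + - (vs ! j)]"
      unfolding nielsen_move_rel_def inv_Zn by (auto simp: Zn_def)
    then obtain s where ys: "ys = xs[i := xs ! i + s]" and s: "s = vs ! j \<or> s = - (vs ! j)"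
      by blast
    have "vs ! j \<in> zv.span (set vs)" by (rule zv.span_base) (use ij in simp)
    then have v: "s \<in> zv.span (set vs)" using s by (auto intro: zv.span_neg)
    moreover have "zv.span (set vs) \<subseteq> zv.span (set vs \<union> {xs ! j | j. j < length xs \<and> j \<noteq> i})"
      by (rule zv.span_mono) simp
    ultimately have "s \<in> zv.span (set vs \<union> {xs ! j | j. j < length xs \<and> j \<noteq> i})" by (rule rev_subsetD)
    then have "zv.span (set vs \<union> set ys) = zv.span (set vs \<union> set xs)"
      unfolding ys by (rule span_update[OF ij(1)])
    moreover have "?cl (xs ! i + s) = ?cl (xs ! i)"
      using v by (simp add: quot_class_eq_iff)
    then have "map ?cl ys = map ?cl xs"
      using ij by (simp add: ys map_update list_update_same_conv)
    ultimately show ?case using step.IH by simp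
  qed
qed

context positive_tuples
begin

text \<open>Membership in the generated subgroup is carried along because inverses in the quotient group are
  known only for classes in its carrier.\<close>

lemma lift_nielsen_path:
  assumes "nielsen_equivalent (quot_A ws vs) (map (quot_class vs) ws) ys" "length ws = k"
  shows "\<exists>u. (\<lambda>u u'. \<exists>i. move i u u')\<^sup>*\<^sup>* ((!) ws) u \<and> ys = map (\<lambda>i. quot_class vs (u i)) [0..<k] \<and>
    (\<forall>i<k. u i \<in> zv.span (set vs \<union> set ws))"
  using assms(1) unfolding nielsen_equivalent_def
proof induction
  case base
  have "map (quot_class vs) ws = map (\<lambda>i. quot_class vs (ws ! i)) [0..<k]"
    using assms(2) by (intro nth_equalityI) auto
  moreover have "\<forall>i<k. ws ! i \<in> zv.span (set vs \<union> set ws)"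
    using assms(2) by (auto intro: zv.span_base)
  ultimately show ?case by blast
next
  case (step ys zs)
  let ?Q = "quot_A ws vs" and ?cl = "quot_class vs"
  obtain u where u: "(\<lambda>u u'. \<exists>i. move i u u')\<^sup>*\<^sup>* ((!) ws) u" "ys = map (\<lambda>i. ?cl (u i)) [0..<k]"
    "\<And>i. i < k \<Longrightarrow> u i \<in> zv.span (set vs \<union> set ws)"
    using step.IH by blast
  from step.hyps(2) obtain i j where ij: "i < k" "j < k" "j \<noteq> i"
    and "zs = ys[i := ?cl (u i) \<otimes>\<^bsub>?Q\<^esub> ?cl (u j)] \<or>
      zs = ys[i := ?cl (u i) \<otimes>\<^bsub>?Q\<^esub> inv\<^bsub>?Q\<^esub> ?cl (u j)]"
    unfolding nielsen_move_def u(2) by auto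
  then have "zs = ys[i := ?cl (u i + 1 *s u j)] \<or> zs = ys[i := ?cl (u i + (-1) *s u j)]"
    using u(3)[OF ij(2)] by (simp add: quot_class_add quot_class_minus)
  then obtain s :: int where s: "\<bar>s\<bar> = 1" and zs: "zs = ys[i := ?cl (u i + s *s u j)]"
    by (metis abs_1 abs_minus_cancel)
  let ?u = "u(i := u i + s *s u j)"
  have "move i u ?u" by (rule moveI) (use ij s in \<open>auto simp: addends_def\<close>)
  then have "(\<lambda>u u'. \<exists>i. move i u u')\<^sup>*\<^sup>* ((!) ws) ?u"
    by (intro rtranclp.rtrancl_into_rtrancl[OF u(1)]) blast
  moreover have "zs = map (\<lambda>i. ?cl (?u i)) [0..<k]"
    unfolding zs u(2) by (rule nth_equalityI) (auto simp: nth_list_update)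
  moreover have "\<forall>m<k. ?u m \<in> zv.span (set vs \<union> set ws)"
    using u(3) ij by (auto intro!: zv.span_add zv.span_scale)
  ultimately show ?case by blast
qed

lemma add_relators:
  assumes "finite S" "S \<subseteq> {..<k}" "\<And>i. i < k \<Longrightarrow> w i - u i \<in> zv.span (set vs)"
  shows "(\<lambda>u u'. \<exists>i. move i u u')\<^sup>*\<^sup>* u (\<lambda>i. if i \<in> S then w i else u i)"
  using assms(1,2)
proof induction
  case empty
  then show ?case by simp
next
  case (insert j S)
  let ?u = "\<lambda>i. if i \<in> S then w i else u i"
  have "w j - u j \<in> zv.span (addends j ?u)"
    using assms(3)[of j] insert.prems zv.span_mono[of "set vs" "addends j ?u"] by (auto simp: addends_def)
  then have "(\<lambda>u u'. \<exists>i. move i u u')\<^sup>*\<^sup>* ?u (?u(j := ?u j + (w j - u j)))"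
    using insert.prems by (intro move_path_upd) auto
  moreover have "?u(j := ?u j + (w j - u j)) = (\<lambda>i. if i \<in> insert j S then w i else u i)"
    using insert.hyps by (auto simp: fun_eq_iff)
  ultimately show ?case using insert.IH insert.prems by (metis (no_types, lifting) insert_subset rtranclp_trans)
qed

end

theorem theoremB1:
  fixes vs ws ws' :: "(int ^ 'n) list" and M :: int and k :: nat
  assumes "M \<ge> 1"
    and "k \<ge> 3"
    and "length ws = k" and "length ws' = k"
    and "M_big M ws" and "M_big M ws'"
  shows "(big_step M vs)\<^sup>*\<^sup>* ws ws' \<longleftrightarrow>
    generate Zn (set vs \<union> set ws) = generate Zn (set vs \<union> set ws') \<and>
    nielsen_equivalent (quot_A ws vs) (map (quot_class vs) ws) (map (quot_class vs) ws')"
proof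
  assume "(big_step M vs)\<^sup>*\<^sup>* ws ws'"
  from big_step_path_imp_nielsen_equivalent[OF this]
  show "generate Zn (set vs \<union> set ws) = generate Zn (set vs \<union> set ws') \<and>
    nielsen_equivalent (quot_A ws vs) (map (quot_class vs) ws) (map (quot_class vs) ws')"
    by (simp add: generate_Zn)
next
  interpret positive_tuples M k vs using assms by unfold_locales
  assume "generate Zn (set vs \<union> set ws) = generate Zn (set vs \<union> set ws') \<and>
    nielsen_equivalent (quot_A ws vs) (map (quot_class vs) ws) (map (quot_class vs) ws')"
  then obtain u where u: "(\<lambda>u u'. \<exists>i. move i u u')\<^sup>*\<^sup>* ((!) ws) u"
    "map (quot_class vs) ws' = map (\<lambda>i. quot_class vs (u i)) [0..<k]"
    using lift_nielsen_path assms(3) by blast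
  have "ws' ! i - u i \<in> zv.span (set vs)" if "i < k" for i
  proof -
    have "map (quot_class vs) ws' ! i = map (\<lambda>i. quot_class vs (u i)) [0..<k] ! i" by (simp add: u(2))
    then show ?thesis using that assms(4) by (simp add: quot_class_eq_iff)
  qed
  then have "(\<lambda>u u'. \<exists>i. move i u u')\<^sup>*\<^sup>* u (\<lambda>i. if i \<in> {..<k} then ws' ! i else u i)"
    by (intro add_relators) auto
  with u(1) have "(\<lambda>u u'. \<exists>i. move i u u')\<^sup>*\<^sup>* ((!) ws) (\<lambda>i. if i \<in> {..<k} then ws' ! i else u i)"
    by (rule rtranclp_trans)
  then have "big_move\<^sup>*\<^sup>* ((!) ws) (\<lambda>i. if i \<in> {..<k} then ws' ! i else u i)"
    by (rule move_path_imp_big_path) (use assms in \<open>auto simp: all_big_def big_def M_big_def\<close>)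
  from big_path_imp_big_step_path[OF this]
  have "(big_step M vs)\<^sup>*\<^sup>* (map ((!) ws) [0..<k]) (map (\<lambda>i. if i \<in> {..<k} then ws' ! i else u i) [0..<k])" .
  moreover have "map ((!) ws) [0..<k] = ws" using assms(3) map_nth by blast
  moreover have "map (\<lambda>i. if i \<in> {..<k} then ws' ! i else u i) [0..<k] = ws'"
    using assms(4) by (intro nth_equalityI) auto
  ultimately show "(big_step M vs)\<^sup>*\<^sup>* ws ws'" by simp
qed

end
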